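(* Let $n\ge 2$ be an integer and let $K$ be an algebraic number field of degree $[K:\mathbb{Q}]=n$ such that $K/\mathbb{Q}$ is a Galois extension, with ring of integers $\mathcal{O}_K$. Let $p$ be a prime number and write $p\mathcal{O}_K=P_1^{e}P_2^{e}\cdots P_g^{e}$ with positive integers $g,e$ and pairwise distinct prime ideals $P_1,\dots,P_g$ of $\mathcal{O}_K$. Then $$\tau(p\mathcal{O}_K)\ge \tau^{(e)}(p\mathcal{O}_K)+\frac{\tau(p\mathcal{O}_K)}{\omega(p\mathcal{O}_K)}\cdot\frac{g}{e+1}.$$ Moreover, equality holds if and only if $p\mathcal{O}_K$ is a prime ideal or $p\mathcal{O}_K=P^2$ for some prime ideal $P$ of $\mathcal{O}_K$.
   Context: For a positive integer $m$, $\tau(m)$ is the number of positive divisors of $m$. If $J=P_1^{e_1}\cdots P_g^{e_g}$ is the factorization of a nonzero proper ideal $J$ of $\mathcal{O}_K$ into pairwise distinct nonzero prime ideals with positive exponents, then $\tau(J)$ is the number of ideals $P_1^{a_1}\cdots P_g^{a_g}$ with $0\le a_i\le e_i$ (so $\tau(J)=\prod_i(e_i+1)$); $\tau^{(e)}(J)$ is the number of exponential divisors of $J$, i.e. ideals $P_1^{b_1}\cdots P_g^{b_g}$ with positive integers $b_i\mid e_i$ (so $\tau^{(e)}(J)=\prod_i\tau(e_i)$); and $\omega(J)=g$. *)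

theory Defs
  imports
    "HOL-Computational_Algebra.Primes"
    "HOL-Algebra.Ideal_Product"
    "HOL-Algebra.Generated_Fields"
    "HOL-Algebra.Finite_Extensions"
begin

section \<open>Number fields\<close>

definition rational_subfield :: "('a, 'm) ring_scheme \<Rightarrow> 'a set"
  where "rational_subfield K = generate_field K {}"

text \<open>The injectivity condition says that \<open>K\<close> has characteristic \<open>0\<close>, so that
  the prime subfield \<^term>\<open>rational_subfield K\<close> is a copy of the field of rational numbers.\<close>

definition number_field :: "('a, 'm) ring_scheme \<Rightarrow> bool"
  where "number_field K \<longleftrightarrow>
    field K \<and>
    inj (\<lambda>m::int. [m] \<cdot>\<^bsub>K\<^esub> \<one>\<^bsub>K\<^esub>) \<and>
    ring.finite_dimension K (rational_subfield K) (carrier K)"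

definition number_field_degree :: "('a, 'm) ring_scheme \<Rightarrow> nat"
  where "number_field_degree K = ring.dim K (rational_subfield K) (carrier K)"

definition galois_extension :: "('a, 'm) ring_scheme \<Rightarrow> 'a set \<Rightarrow> bool"
  where "galois_extension K F \<longleftrightarrow>
    subfield F K \<and>
    ring.finite_dimension K F (carrier K) \<and>
    {x \<in> carrier K. \<forall>\<sigma> \<in> ring_iso K K. (\<forall>y \<in> F. \<sigma> y = y) \<longrightarrow> \<sigma> x = x} = F"

text \<open>Polynomials of HOL-Algebra are coefficient lists with the leading coefficient first.\<close>

definition integral_over :: "('a, 'm) ring_scheme \<Rightarrow> 'a set \<Rightarrow> 'a \<Rightarrow> bool"
  where "integral_over K S x \<longleftrightarrow>
    (\<exists>f. polynomial\<^bsub>K\<^esub> S f \<and> f \<noteq> [] \<and> hd f = \<one>\<^bsub>K\<^esub> \<and> ring.eval K f x = \<zero>\<^bsub>K\<^esub>)"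

definition ring_of_integers :: "('a, 'm) ring_scheme \<Rightarrow> ('a, 'm) ring_scheme"
  where "ring_of_integers K =
    K \<lparr>carrier := {x \<in> carrier K. integral_over K (range (\<lambda>m::int. [m] \<cdot>\<^bsub>K\<^esub> \<one>\<^bsub>K\<^esub>)) x}\<rparr>"


section \<open>Divisor functions of ideals\<close>

definition prime_power_product :: "('a, 'm) ring_scheme \<Rightarrow> 'a set set \<Rightarrow> ('a set \<Rightarrow> nat) \<Rightarrow> 'a set"
  where "prime_power_product R S a =
    (\<Otimes>\<^bsub>ideals_set R\<^esub>P\<in>S. P [^]\<^bsub>ideals_set R\<^esub> a P)"

text \<open>A factorization of \<open>J\<close> is encoded by its exponent function, which vanishes
  at every set that is not one of the prime ideals occurring in \<open>J\<close>.\<close>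

definition is_ideal_factorization :: "('a, 'm) ring_scheme \<Rightarrow> 'a set \<Rightarrow> ('a set \<Rightarrow> nat) \<Rightarrow> bool"
  where "is_ideal_factorization R J a \<longleftrightarrow>
    finite {P. a P > 0} \<and>
    (\<forall>P. a P > 0 \<longrightarrow> primeideal P R \<and> P \<noteq> {\<zero>\<^bsub>R\<^esub>}) \<and>
    J = prime_power_product R {P. a P > 0} a"

text \<open>The definite description is justified only where factorization into prime ideals exists
  and is unique, as for the nonzero ideals of a Dedekind domain.\<close>

definition ideal_exponent :: "('a, 'm) ring_scheme \<Rightarrow> 'a set \<Rightarrow> 'a set \<Rightarrow> nat"
  where "ideal_exponent R J = (THE a. is_ideal_factorization R J a)"

definition ideal_prime_factors :: "('a, 'm) ring_scheme \<Rightarrow> 'a set \<Rightarrow> 'a set set"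
  where "ideal_prime_factors R J = {P. ideal_exponent R J P > 0}"

definition ideal_tau :: "('a, 'm) ring_scheme \<Rightarrow> 'a set \<Rightarrow> nat"
  where "ideal_tau R J =
    card {prime_power_product R (ideal_prime_factors R J) a | a.
            \<forall>P \<in> ideal_prime_factors R J. a P \<le> ideal_exponent R J P}"

definition ideal_tau_exp :: "('a, 'm) ring_scheme \<Rightarrow> 'a set \<Rightarrow> nat"
  where "ideal_tau_exp R J =
    card {prime_power_product R (ideal_prime_factors R J) b | b.
            \<forall>P \<in> ideal_prime_factors R J. b P > 0 \<and> b P dvd ideal_exponent R J P}"

definition ideal_omega :: "('a, 'm) ring_scheme \<Rightarrow> 'a set \<Rightarrow> nat"
  where "ideal_omega R J = card (ideal_prime_factors R J)"

end

theory Submission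
  imports Defs
begin

text \<open>
  The factors of a principal ideal generated by a non-zero-divisor can be cancelled. In a
  commutative ring this suffices for the uniqueness of its factorization into prime ideals: an
  inclusion-minimal prime among those of two factorizations occurs in both of them and can be
  cancelled. Hence no Dedekind theory is needed, and with \<open>d\<close> the number of divisors of \<open>e\<close> the
  claim becomes \<open>e * (e + 1) ^ (g - 1) \<ge> d ^ g\<close>, which holds since \<open>d \<le> e\<close>; equality forces
  \<open>g = 1\<close> and \<open>d = e\<close>, that is, \<open>e \<in> {1, 2}\<close>.
\<close>

section \<open>Cancellable ideals\<close>

text \<open>A substitute for invertibility that needs no fractional ideals. It is a property of one
  ideal, so that it can be passed on from a product to its factors.\<close>

definition cancellable_ideal :: "('a, 'm) ring_scheme \<Rightarrow> 'a set \<Rightarrow> bool"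
  where "cancellable_ideal R I \<longleftrightarrow>
    (\<forall>A B. ideal A R \<longrightarrow> ideal B R \<longrightarrow> I \<cdot>\<^bsub>R\<^esub> A = I \<cdot>\<^bsub>R\<^esub> B \<longrightarrow> A = B)"

lemma ideals_set_simps [simp]:
  "carrier (ideals_set R) = {I. ideal I R}"
  "mult (ideals_set R) = ideal_prod R"
  "one (ideals_set R) = carrier R"
  by (simp_all add: ideals_set_def)

context cring
begin

interpretation I: comm_monoid "ideals_set R"
  by (rule ideals_set_is_comm_monoid)

text \<open>Multiplying \<open>I \<cdot> A = I \<cdot> B\<close> by \<open>J\<close> yields an
  equation in which the product \<open>I \<cdot> J\<close> can be cancelled.\<close>

lemma cancellable_ideal_factor:
  assumes "ideal I R" "ideal J R" "cancellable_ideal R (I \<cdot> J)"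
  shows "cancellable_ideal R I"
  unfolding cancellable_ideal_def
proof (intro allI impI)
  fix A B assume AB: "ideal A R" "ideal B R" "I \<cdot> A = I \<cdot> B"
  have "(I \<cdot> J) \<cdot> A = J \<cdot> (I \<cdot> A)" "(I \<cdot> J) \<cdot> B = J \<cdot> (I \<cdot> B)"
    using AB assms by (metis ideal_prod_assoc ideal_prod_commute)+
  then show "A = B"
    using AB assms(3) unfolding cancellable_ideal_def by metis
qed

text \<open>A generator \<open>(r \<otimes> x) \<otimes> j\<close> of the product equals
  \<open>(r \<otimes> j) \<otimes> x\<close> with \<open>r \<otimes> j\<close> in \<open>A\<close>,
  and sums of such multiples of \<open>x\<close> are collected by distributivity.\<close>

lemma cgenideal_ideal_prod:
  assumes x: "x \<in> carrier R" and A: "ideal A R"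
  shows "(PIdl x) \<cdot> A = {a \<otimes> x | a. a \<in> A}"
proof
  show "(PIdl x) \<cdot> A \<subseteq> {a \<otimes> x | a. a \<in> A}"
  proof
    fix s assume "s \<in> (PIdl x) \<cdot> A"
    then show "s \<in> {a \<otimes> x | a. a \<in> A}"
    proof induct
      case (prod i j)
      then obtain r where r: "r \<in> carrier R" "i = r \<otimes> x"
        unfolding cgenideal_def by blast
      have j: "j \<in> carrier R" using A prod(2) by (rule ideal.Icarr)
      have "i \<otimes> j = (r \<otimes> j) \<otimes> x" using r j x by (simp add: m_ac)
      moreover have "r \<otimes> j \<in> A" using A prod(2) r(1) by (rule ideal.I_l_closed)
      ultimately show ?case by blast
    next
      case (sum s t)
      then obtain a b where ab: "a \<in> A" "b \<in> A" "s = a \<otimes> x" "t = b \<otimes> x" by blast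
      then have "s \<oplus> t = (a \<oplus> b) \<otimes> x"
        using x A by (simp add: ideal.Icarr l_distr)
      moreover have "a \<oplus> b \<in> A"
        using A ab by (simp add: additive_subgroup.a_closed ideal.axioms(1))
      ultimately show ?case by blast
    qed
  qed
next
  show "{a \<otimes> x | a. a \<in> A} \<subseteq> (PIdl x) \<cdot> A"
  proof
    fix s assume "s \<in> {a \<otimes> x | a. a \<in> A}"
    then obtain a where a: "a \<in> A" "s = x \<otimes> a"
      using A x by (auto simp: ideal.Icarr m_comm)
    then show "s \<in> (PIdl x) \<cdot> A"
      using cgenideal_self[OF x] by (simp add: ideal_prod.prod)
  qed
qed

text \<open>Every element of the product has the form \<open>a \<otimes> x\<close>, and regularity
  of \<open>x\<close> recovers \<open>a\<close> from it.\<close>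

lemma cancellable_cgenideal:
  assumes x: "x \<in> carrier R"
    and reg: "\<And>a b. a \<in> carrier R \<Longrightarrow> b \<in> carrier R \<Longrightarrow> a \<otimes> x = b \<otimes> x \<Longrightarrow> a = b"
  shows "cancellable_ideal R (PIdl x)"
  unfolding cancellable_ideal_def
proof (intro allI impI)
  have sub: "A \<subseteq> B" if "ideal A R" "ideal B R" "(PIdl x) \<cdot> A = (PIdl x) \<cdot> B" for A B
  proof
    fix a assume a: "a \<in> A"
    then have "a \<otimes> x \<in> {b \<otimes> x | b. b \<in> B}"
      using that x cgenideal_ideal_prod by blast
    then obtain b where "b \<in> B" "a \<otimes> x = b \<otimes> x" by blast
    then show "a \<in> B" using reg a that by (metis ideal.Icarr)
  qed
  fix A B assume "ideal A R" "ideal B R" "(PIdl x) \<cdot> A = (PIdl x) \<cdot> B"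
  then show "A = B" using sub[of A B] sub[of B A] by simp
qed


section \<open>Products of prime ideals\<close>

lemma ideal_pow: "ideal P R \<Longrightarrow> ideal (P [^]\<^bsub>ideals_set R\<^esub> (k::nat)) R"
  using I.nat_pow_closed[of P k] by simp

lemma ideal_prime_power_product:
  assumes "\<And>P. P \<in> S \<Longrightarrow> ideal P R"
  shows "ideal (prime_power_product R S a) R"
  using I.finprod_closed[of "\<lambda>P. P [^]\<^bsub>ideals_set R\<^esub> a P" S] assms
  by (auto simp: prime_power_product_def ideal_pow)

lemma prime_power_product_add:
  assumes "\<And>P. P \<in> S \<Longrightarrow> ideal P R"
  shows "prime_power_product R S (\<lambda>P. a P + b P)
       = prime_power_product R S a \<cdot> prime_power_product R S b"
proof -
  have "prime_power_product R S (\<lambda>P. a P + b P) =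
      (\<Otimes>\<^bsub>ideals_set R\<^esub>P\<in>S. (P [^]\<^bsub>ideals_set R\<^esub> a P) \<otimes>\<^bsub>ideals_set R\<^esub> (P [^]\<^bsub>ideals_set R\<^esub> b P))"
    unfolding prime_power_product_def
  proof (rule I.finprod_cong')
    show "(\<lambda>P. (P [^]\<^bsub>ideals_set R\<^esub> a P) \<otimes>\<^bsub>ideals_set R\<^esub> (P [^]\<^bsub>ideals_set R\<^esub> b P))
        \<in> S \<rightarrow> carrier (ideals_set R)"
      using assms by (auto simp: ideal_pow ideal_prod_is_ideal)
    show "P [^]\<^bsub>ideals_set R\<^esub> (a P + b P)
        = (P [^]\<^bsub>ideals_set R\<^esub> a P) \<otimes>\<^bsub>ideals_set R\<^esub> (P [^]\<^bsub>ideals_set R\<^esub> b P)" if "P \<in> S" for P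
      using I.nat_pow_mult[of P "a P" "b P"] assms[OF that] by simp
  qed simp
  also have "\<dots> = prime_power_product R S a \<cdot> prime_power_product R S b"
    unfolding prime_power_product_def
    using assms by (subst I.finprod_multf) (auto simp: ideal_pow)
  finally show ?thesis .
qed

lemma prime_power_product_single:
  assumes "\<And>P. P \<in> S \<Longrightarrow> ideal P R" "finite S" "Q \<in> S"
  shows "prime_power_product R S (\<lambda>P. if P = Q then 1 else 0) = Q"
proof -
  have "prime_power_product R S (\<lambda>P. if P = Q then 1 else 0)
      = (\<Otimes>\<^bsub>ideals_set R\<^esub>P\<in>S. if P = Q then P else \<one>\<^bsub>ideals_set R\<^esub>)"
    unfolding prime_power_product_def
    by (rule I.finprod_cong') (use assms(1) oneideal I.nat_pow_eone in auto)
  also have "\<dots> = Q"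
    using I.finprod_singleton_swap[of Q S "\<lambda>P. P"] assms by auto
  finally show ?thesis .
qed

lemma prime_power_product_remove:
  assumes "\<And>P. P \<in> S \<Longrightarrow> ideal P R" "finite S" "Q \<in> S" "a Q > 0"
  shows "prime_power_product R S a = Q \<cdot> prime_power_product R S (a(Q := a Q - 1))"
proof -
  \<comment> \<open>One copy of \<open>Q\<close> is split off as an indicator exponent; the
    truncated subtraction is exact because \<open>a Q > 0\<close>.\<close>
  have a: "a = (\<lambda>P. (if P = Q then 1 else 0) + (a(Q := a Q - 1)) P)"
    using assms(4) by auto
  show ?thesis
    by (subst a, subst prime_power_product_add)
      (simp_all add: assms(1) prime_power_product_single[OF assms(1-3)])
qed

lemma prime_power_product_subset:
  assumes "\<And>P. P \<in> S \<Longrightarrow> ideal P R" "finite S" "Q \<in> S" "a Q > 0"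
  shows "prime_power_product R S a \<subseteq> Q"
  using prime_power_product_remove[of S Q a] ideal_prod_inter[OF assms(1)[OF assms(3)]]
    ideal_prime_power_product[of S] assms by (metis le_inf_iff)

text \<open>The power with exponent 0 is the whole ring, which a prime ideal cannot contain; this
  gives the positivity. Otherwise primality yields a factor inside \<open>Q\<close>.\<close>

lemma pow_subset_primeideal:
  assumes "ideal P R" "primeideal Q R" "P [^]\<^bsub>ideals_set R\<^esub> (k::nat) \<subseteq> Q"
  shows "k > 0 \<and> P \<subseteq> Q"
  using assms(3)
proof (induct k)
  case 0
  then show ?case
    using primeideal.I_notcarr[OF assms(2)]
      additive_subgroup.a_subset[OF ideal.axioms(1)[OF primeideal.axioms(1)[OF assms(2)]]]
    by auto
next
  case (Suc k)
  then show ?case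
    using primeideal_divides_ideal_prod[OF assms(2) ideal_pow[OF assms(1), of k] assms(1)] by auto
qed

lemma prime_power_product_subset_primeideal:
  assumes "finite S" "\<And>P. P \<in> S \<Longrightarrow> ideal P R" "primeideal Q R"
    "prime_power_product R S a \<subseteq> Q"
  shows "\<exists>P\<in>S. a P > 0 \<and> P \<subseteq> Q"
  using assms(1,2,4)
proof (induct S)
  case empty
  then show ?case
    using assms(3) pow_subset_primeideal[OF oneideal assms(3), of 0]
    by (simp add: prime_power_product_def)
next
  case (insert P S)
  have "prime_power_product R (insert P S) a
      = (P [^]\<^bsub>ideals_set R\<^esub> a P) \<cdot> prime_power_product R S a"
    using insert I.finprod_insert[of S P "\<lambda>P. P [^]\<^bsub>ideals_set R\<^esub> a P"]
    by (auto simp: prime_power_product_def ideal_pow)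
  then have "P [^]\<^bsub>ideals_set R\<^esub> a P \<subseteq> Q \<or> prime_power_product R S a \<subseteq> Q"
    using primeideal_divides_ideal_prod[OF assms(3)] insert
    by (simp add: ideal_pow ideal_prime_power_product)
  then show ?case
    using insert pow_subset_primeideal[OF _ assms(3), of P "a P"] by auto
qed

text \<open>Induction on the total exponent of \<open>a\<close>: one prime that occurs on both sides
  is cancelled. Distinct primes of \<open>S\<close> may be nested, so the prime to cancel has to be
  chosen minimal.\<close>

lemma prime_power_product_inject:
  assumes "finite S" "\<And>P. P \<in> S \<Longrightarrow> primeideal P R"
    and "cancellable_ideal R (prime_power_product R S a)"
    and "prime_power_product R S a = prime_power_product R S b"
  shows "\<forall>P\<in>S. a P = b P"
  using assms(3,4)
proof (induct "sum a S" arbitrary: a b rule: less_induct)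
  case less
  have id: "ideal P R" if "P \<in> S" for P
    using assms(2)[OF that] by (rule primeideal.axioms)
  \<comment> \<open>The primes that occur on at least one side; if there are none, all exponents on
    \<open>S\<close> are 0.\<close>
  define T where "T = {P \<in> S. a P > 0 \<or> b P > 0}"
  show ?case
  proof (cases "T = {}")
    case True
    then show ?thesis by (auto simp: T_def)
  next
    case False
    moreover have "finite T" using assms(1) by (simp add: T_def)
    ultimately obtain Q where Q: "Q \<in> T" and min: "\<And>P. P \<in> T \<Longrightarrow> P \<subseteq> Q \<Longrightarrow> P = Q"
      by (metis finite_has_minimal)
    have QS: "Q \<in> S" using Q by (simp add: T_def)
    have "prime_power_product R S a \<subseteq> Q"
      using Q prime_power_product_subset[of S Q a] prime_power_product_subset[of S Q b]
        id assms(1) less.prems(2) by (auto simp: T_def)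
    \<comment> \<open>The prime \<open>Q\<close> contains the product, hence some prime
      \<open>P\<close> that occurs in it; minimality of \<open>Q\<close> in \<open>T\<close> forces
      \<open>P = Q\<close>. Applied to both sides, this shows that \<open>Q\<close> occurs in
      each.\<close>
    moreover have "c Q > 0" if c: "prime_power_product R S c \<subseteq> Q" "c = a \<or> c = b" for c
    proof -
      obtain P where P: "P \<in> S" "c P > 0" "P \<subseteq> Q"
        using prime_power_product_subset_primeideal[OF assms(1) id assms(2)[OF QS] c(1)] by blast
      then have "P \<in> T" using c(2) by (auto simp: T_def)
      then show ?thesis using min P by blast
    qed
    ultimately have pos: "a Q > 0" "b Q > 0"
      using less.prems(2) by simp_all
    let ?a = "a(Q := a Q - 1)" and ?b = "b(Q := b Q - 1)"
    have rem: "prime_power_product R S c = Q \<cdot> prime_power_product R S (c(Q := c Q - 1))"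
      if "c Q > 0" for c
      by (rule prime_power_product_remove) (use id assms(1) QS that in auto)
    have idp: "ideal (prime_power_product R S c) R" for c
      by (rule ideal_prime_power_product[OF id])
    \<comment> \<open>Both factors inherit cancellability: that of \<open>Q\<close> permits the
      division, that of the remaining product is required by the induction hypothesis.\<close>
    have "cancellable_ideal R (Q \<cdot> prime_power_product R S ?a)"
      using less.prems(1) rem[of a, OF pos(1)] by simp
    then have "cancellable_ideal R Q" "cancellable_ideal R (prime_power_product R S ?a)"
      using cancellable_ideal_factor[OF id[OF QS] idp[of ?a]]
        cancellable_ideal_factor[OF idp[of ?a] id[OF QS]]
        ideal_prod_commute[OF id[OF QS] idp[of ?a]] by simp_all
    moreover from this(1) have "prime_power_product R S ?a = prime_power_product R S ?b"
      using less.prems(2) rem[of a, OF pos(1)] rem[of b, OF pos(2)] idp[of ?a] idp[of ?b]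
      unfolding cancellable_ideal_def by simp
    moreover have "sum ?a S < sum a S"
      using assms(1) QS pos(1) by (intro sum_strict_mono_ex1) auto
    ultimately have eq: "\<forall>P\<in>S. ?a P = ?b P"
      using less.hyps by blast
    have "a P = b P" if "P \<in> S" for P
      using bspec[OF eq that] pos by (cases "P = Q") auto
    then show ?thesis by blast
  qed
qed

section \<open>Unique exponents and the counting of divisors\<close>

lemma prime_power_product_mono_neutral:
  assumes "finite S" "\<And>P. P \<in> S \<Longrightarrow> ideal P R" "{P. a P > 0} \<subseteq> S"
  shows "prime_power_product R {P. a P > 0} a = prime_power_product R S a"
  unfolding prime_power_product_def
  by (rule I.finprod_mono_neutral_cong_left) (use assms in \<open>auto simp: ideal_pow\<close>)

lemma ideal_exponent_eqI:
  assumes canc: "cancellable_ideal R J" and a: "is_ideal_factorization R J a"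
  shows "ideal_exponent R J = a"
  unfolding ideal_exponent_def
proof (rule the_equality)
  show "is_ideal_factorization R J a" by (rule a)
next
  fix b assume b: "is_ideal_factorization R J b"
  \<comment> \<open>Two factorizations become comparable over the union of their supports, since
    exponents 0 contribute only the unit ideal; off this union both functions vanish.\<close>
  let ?S = "{P. a P > 0} \<union> {P. b P > 0}"
  have S: "finite ?S" "\<And>P. P \<in> ?S \<Longrightarrow> primeideal P R"
    using a b by (auto simp: is_ideal_factorization_def)
  then have id: "\<And>P. P \<in> ?S \<Longrightarrow> ideal P R"
    by (meson primeideal.axioms(1))
  have "prime_power_product R ?S a = J" "prime_power_product R ?S b = J"
    using prime_power_product_mono_neutral[OF S(1) id, of a]
      prime_power_product_mono_neutral[OF S(1) id, of b] a b
    unfolding is_ideal_factorization_def by blast+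
  with canc have eq: "cancellable_ideal R (prime_power_product R ?S a)"
    "prime_power_product R ?S a = prime_power_product R ?S b"
    by (simp_all only:)
  have ab: "\<forall>P\<in>?S. a P = b P"
    by (rule prime_power_product_inject[OF S(1) _ eq]) (rule S(2))
  show "b = a"
  proof
    fix P
    show "b P = a P" using ab[rule_format, of P] by (cases "P \<in> ?S") auto
  qed
qed

text \<open>The common count behind \<open>ideal_tau\<close> and \<open>ideal_tau_exp\<close>, where
  \<open>B P\<close> holds the exponents allowed at \<open>P\<close>. The bound by
  \<open>a P\<close> makes each product a factor of \<open>J\<close>, hence cancellable, so that it
  determines its exponents.\<close>

lemma card_prime_power_products:
  assumes canc: "cancellable_ideal R J" and a: "is_ideal_factorization R J a"
    and B: "\<And>P k. a P > 0 \<Longrightarrow> k \<in> B P \<Longrightarrow> k \<le> a P"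
  shows "card {prime_power_product R {P. a P > 0} b | b. \<forall>P \<in> {P. a P > 0}. b P \<in> B P}
       = (\<Prod>P | a P > 0. card (B P))"
proof -
  let ?S = "{P. a P > 0}"
  let ?f = "prime_power_product R ?S"
  have S: "finite ?S" "\<And>P. P \<in> ?S \<Longrightarrow> primeideal P R" "J = ?f a"
    using a by (auto simp: is_ideal_factorization_def)
  then have id: "\<And>P. P \<in> ?S \<Longrightarrow> ideal P R"
    by (meson primeideal.axioms(1))
  have cong: "?f b = ?f c" if "\<And>P. P \<in> ?S \<Longrightarrow> b P = c P" for b c
    unfolding prime_power_product_def
    by (rule I.finprod_cong') (use id that in \<open>auto simp: ideal_pow\<close>)
  \<comment> \<open>Restricting to \<open>PiE\<close> fixes the values off the support, which do not
    affect the product but would spoil injectivity.\<close>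
  have eq: "{?f b | b. \<forall>P \<in> ?S. b P \<in> B P} = ?f ` PiE ?S B"
  proof (intro equalityI subsetI)
    fix Y assume "Y \<in> {?f b | b. \<forall>P \<in> ?S. b P \<in> B P}"
    then obtain b where "Y = ?f b" "\<forall>P \<in> ?S. b P \<in> B P" by blast
    then have "Y = ?f (restrict b ?S)" "restrict b ?S \<in> PiE ?S B"
      using cong[of b "restrict b ?S"] by auto
    then show "Y \<in> ?f ` PiE ?S B" by blast
  qed (auto simp: PiE_mem)
  have "inj_on ?f (PiE ?S B)"
  proof (rule inj_onI)
    fix b c assume b: "b \<in> PiE ?S B" and c: "c \<in> PiE ?S B" and bc: "?f b = ?f c"
    \<comment> \<open>The exponents \<open>a P - b P\<close> describe the cofactor of
      \<open>?f b\<close> in \<open>J\<close>; the subtraction is exact because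
      \<open>b P \<le> a P\<close> on the support.\<close>
    have "?f a = ?f (\<lambda>P. b P + (a P - b P))"
      by (rule cong) (use b B in \<open>simp add: PiE_mem\<close>)
    also have "\<dots> = ?f b \<cdot> ?f (\<lambda>P. a P - b P)"
      by (rule prime_power_product_add[OF id])
    finally have "cancellable_ideal R (?f b)"
      using cancellable_ideal_factor[OF ideal_prime_power_product[OF id] ideal_prime_power_product[OF id]]
        canc S(3) by metis
    then have "\<forall>P\<in>?S. b P = c P"
      using prime_power_product_inject[OF S(1,2) _ bc] by blast
    then show "b = c" using b c by (metis PiE_ext)
  qed
  then show ?thesis
    by (simp only: eq card_image card_PiE[OF S(1)])
qed

lemma ideal_divisor_functions:
  assumes "cancellable_ideal R J" "is_ideal_factorization R J a"
  shows "ideal_omega R J = card {P. a P > 0}"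
    and "ideal_tau R J = (\<Prod>P | a P > 0. a P + 1)"
    and "ideal_tau_exp R J = (\<Prod>P | a P > 0. card {d. d dvd a P})"
proof -
  note ex = ideal_exponent_eqI[OF assms]
  show "ideal_omega R J = card {P. a P > 0}"
    by (simp add: ideal_omega_def ideal_prime_factors_def ex)
  show "ideal_tau R J = (\<Prod>P | a P > 0. a P + 1)"
    using card_prime_power_products[OF assms, of "\<lambda>P. {..a P}"]
    by (simp add: ideal_tau_def ideal_prime_factors_def ex)
  \<comment> \<open>A divisor of a positive exponent is positive, so the condition on
    \<open>b\<close> takes the form of membership in \<open>B P\<close>.\<close>
  have "{prime_power_product R {P. a P > 0} b | b. \<forall>P\<in>{P. a P > 0}. b P > 0 \<and> b P dvd a P}
      = {prime_power_product R {P. a P > 0} b | b. \<forall>P\<in>{P. a P > 0}. b P \<in> {d. d dvd a P}}"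
    by (rule Collect_cong) (use dvd_pos_nat in blast)
  then show "ideal_tau_exp R J = (\<Prod>P | a P > 0. card {d. d dvd a P})"
    using card_prime_power_products[OF assms, of "\<lambda>P. {d. d dvd a P}"]
    by (simp only: ideal_tau_exp_def ideal_prime_factors_def ex) (simp add: dvd_imp_le)
qed

text \<open>The primes are nonzero because each contains the nonzero ideal \<open>J\<close>.\<close>

lemma is_ideal_factorization_uniform:
  assumes "finite S" "\<And>P. P \<in> S \<Longrightarrow> primeideal P R" "(e::nat) > 0" "J \<noteq> {\<zero>}"
    and J: "J = (\<Otimes>\<^bsub>ideals_set R\<^esub>P\<in>S. P [^]\<^bsub>ideals_set R\<^esub> e)"
  shows "is_ideal_factorization R J (\<lambda>P. if P \<in> S then e else 0)"
proof -
  have id: "\<And>P. P \<in> S \<Longrightarrow> ideal P R"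
    using assms(2) by (meson primeideal.axioms(1))
  have J': "J = prime_power_product R S (\<lambda>P. if P \<in> S then e else 0)"
    unfolding J prime_power_product_def
    by (rule I.finprod_cong') (use id in \<open>auto simp: ideal_pow\<close>)
  have "P \<noteq> {\<zero>}" if "P \<in> S" for P
  proof -
    have "J \<subseteq> P"
      unfolding J' by (rule prime_power_product_subset) (use id that assms(1,3) in auto)
    moreover have "\<zero> \<in> J"
      unfolding J' using ideal_prime_power_product[OF id]
      by (meson additive_subgroup.zero_closed ideal.axioms(1))
    ultimately show ?thesis using assms(4) by blast
  qed
  then show ?thesis
    using assms(1-3) J' by (simp add: is_ideal_factorization_def)
qed

end


section \<open>The main inequality\<close>

lemma card_divisors_le: "card {d. d dvd (e::nat)} \<le> e" if "e > 0"
proof -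
  have "{d. d dvd e} \<subseteq> {1..e}"
    using that by (auto simp: dvd_imp_le dvd_pos_nat Suc_le_eq)
  then show ?thesis
    using card_mono[of "{1..e}"] by fastforce
qed

text \<open>Equality would make every number from 1 to \<open>e\<close> a divisor. For
  \<open>e \<ge> 3\<close> this fails at \<open>e - 1\<close>, which would also have to divide the
  difference 1.\<close>

lemma card_divisors_eq_iff: "card {d. d dvd (e::nat)} = e \<longleftrightarrow> e = 1 \<or> e = 2" if "e > 0"
proof
  assume eq: "card {d. d dvd e} = e"
  have "{d. d dvd e} \<subseteq> {1..e}"
    using that by (auto simp: dvd_imp_le dvd_pos_nat Suc_le_eq)
  then have all: "{d. d dvd e} = {1..e}"
    using eq by (intro card_subset_eq) auto
  show "e = 1 \<or> e = 2"
  proof (rule ccontr)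
    assume "\<not> ?thesis"
    then have "e \<ge> 3" using that by simp
    then have "e - 1 \<in> {1..e}" by auto
    then have "e - 1 dvd e" using all by blast
    then have "e - 1 dvd e - (e - 1)" by simp
    then show False using \<open>e \<ge> 3\<close> by simp
  qed
next
  have "{d. d dvd (2::nat)} = {1, 2}"
    using prime_nat_iff two_is_prime_nat by auto
  then show "e = 1 \<or> e = 2 \<Longrightarrow> card {d. d dvd e} = e" by auto
qed

text \<open>Here \<open>h\<close> stands for \<open>g - 1\<close> and \<open>d\<close> for the
  number of divisors of \<open>e\<close>. One factor \<open>d\<close> is compared with
  \<open>e\<close> and the other \<open>h\<close> factors with \<open>e + 1\<close>; the latter
  comparison is strict as soon as \<open>h > 0\<close>.\<close>

lemma power_le_mult_power:
  fixes d e h :: nat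
  assumes "d \<le> e" "e > 0"
  shows "d ^ Suc h \<le> e * (e + 1) ^ h" "d ^ Suc h = e * (e + 1) ^ h \<longleftrightarrow> h = 0 \<and> d = e"
proof -
  have *: "d ^ h \<le> (e + 1) ^ h" using assms by (intro power_mono) auto
  then show "d ^ Suc h \<le> e * (e + 1) ^ h"
    using assms(1) by (simp add: mult_mono)
  show "d ^ Suc h = e * (e + 1) ^ h \<longleftrightarrow> h = 0 \<and> d = e"
  proof
    assume eq: "d ^ Suc h = e * (e + 1) ^ h"
    have "d = e"
    proof (rule ccontr)
      assume "d \<noteq> e"
      have "d * d ^ h \<le> d * (e + 1) ^ h" using * by simp
      also have "\<dots> < e * (e + 1) ^ h" using assms(1) \<open>d \<noteq> e\<close> by simp
      finally have "d * d ^ h < e * (e + 1) ^ h" .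
      then show False using eq by simp
    qed
    moreover have "h = 0"
    proof (rule ccontr)
      assume "h \<noteq> 0"
      then have "d ^ h < (e + 1) ^ h" using assms by (intro power_strict_mono) auto
      then show False using eq \<open>d = e\<close> assms(2) by simp
    qed
    ultimately show "h = 0 \<and> d = e" by simp
  qed auto
qed

text \<open>That the integral elements are closed under the ring operations is obtained below from the
  prime ideals \<open>P i\<close>, since \<^const>\<open>primeideal\<close> includes \<^const>\<open>cring\<close>.\<close>

lemma domain_ring_of_integers:
  assumes "field K" "cring (ring_of_integers K)"
  shows "domain (ring_of_integers K)"
proof -
  interpret K: field K by fact
  show ?thesis
    by (rule domain.intro[OF assms(2)])
      (unfold_locales, auto simp: ring_of_integers_def K.integral_iff)
qed

section \<open>The ideal generated by a rational prime\<close>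

lemma cancellable_cgenideal_domain:
  assumes "domain R" "x \<in> carrier R" "x \<noteq> \<zero>\<^bsub>R\<^esub>"
  shows "cancellable_ideal R (PIdl\<^bsub>R\<^esub> x)"
proof -
  interpret domain R by fact
  show ?thesis using assms(2,3) by (intro cancellable_cgenideal) (auto simp: m_rcancel)
qed

text \<open>The two rings differ only in their carriers, and a natural multiple is an iterated sum
  starting at zero, which does not refer to the carrier.\<close>

lemma add_pow_one_ring_of_integers:
  "[n] \<cdot>\<^bsub>ring_of_integers K\<^esub> \<one>\<^bsub>ring_of_integers K\<^esub> = [(n::nat)] \<cdot>\<^bsub>K\<^esub> \<one>\<^bsub>K\<^esub>"
  by (simp add: add_pow_def nat_pow_def ring_of_integers_def)

theorem theorem2p12:
  fixes K :: "('a, 'm) ring_scheme"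
    and n p g e :: nat
    and P :: "nat \<Rightarrow> 'a set"
  defines "OK \<equiv> ring_of_integers K"
  defines "pOK \<equiv> PIdl\<^bsub>OK\<^esub> ([p] \<cdot>\<^bsub>OK\<^esub> \<one>\<^bsub>OK\<^esub>)"
  assumes "n \<ge> 2"
    and "number_field K"
    and "number_field_degree K = n"
    and "galois_extension K (rational_subfield K)"
    and "Factorial_Ring.prime p"
    and "g > 0" and "e > 0"
    and "\<forall>i \<in> {1..g}. primeideal (P i) OK"
    and "inj_on P {1..g}"
    and "pOK = (\<Otimes>\<^bsub>ideals_set OK\<^esub>i\<in>{1..g}. P i [^]\<^bsub>ideals_set OK\<^esub> e)"
  shows "real (ideal_tau OK pOK) \<ge> real (ideal_tau_exp OK pOK)
            + real (ideal_tau OK pOK) / real (ideal_omega OK pOK) * (real g / (real e + 1))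
       \<and> (real (ideal_tau OK pOK) = real (ideal_tau_exp OK pOK)
            + real (ideal_tau OK pOK) / real (ideal_omega OK pOK) * (real g / (real e + 1))
         \<longleftrightarrow> primeideal pOK OK \<or> (\<exists>Q. primeideal Q OK \<and> pOK = Q [^]\<^bsub>ideals_set OK\<^esub> (2::nat)))"
proof -
  note K = assms(4)[unfolded number_field_def]
  have prime: "primeideal (P i) OK" if "i \<in> {1..g}" for i
    using assms(10) that by blast
  have "cring OK" using prime[of 1] \<open>g > 0\<close> by (simp add: primeideal_def)
  then have "domain OK" using domain_ring_of_integers[of K] K unfolding OK_def by blast
  then interpret R: domain OK .
  interpret I: comm_monoid "ideals_set OK" by (rule R.ideals_set_is_comm_monoid)
  define x where "x = [p] \<cdot>\<^bsub>OK\<^esub> \<one>\<^bsub>OK\<^esub>"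
  have x: "x \<in> carrier OK" by (simp add: x_def)
  \<comment> \<open>Characteristic 0, in the form of injectivity of the integer multiples of one,
    keeps the generator \<open>x\<close> of \<open>pOK\<close> away from zero.\<close>
  have "add_pow K (int p) \<one>\<^bsub>K\<^esub> \<noteq> add_pow K (0::int) \<one>\<^bsub>K\<^esub>"
    using K prime_gt_0_nat[OF assms(7)] by (auto dest: injD)
  then have x0: "x \<noteq> \<zero>\<^bsub>OK\<^esub>"
    by (simp add: x_def OK_def add_pow_one_ring_of_integers add_pow_int_ge)
      (simp add: ring_of_integers_def add_pow_def nat_pow_def)
  have canc: "cancellable_ideal OK pOK"
    using cancellable_cgenideal_domain[OF R.domain_axioms x x0] by (simp add: pOK_def x_def)
  have pOK0: "pOK \<noteq> {\<zero>\<^bsub>OK\<^esub>}"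
    using R.cgenideal_self[OF x] x0 by (auto simp: pOK_def x_def)
  \<comment> \<open>Stated for an arbitrary set \<open>S\<close> and exponent \<open>k\<close>,
    since it serves both the given factorization and a hypothetical one as a power of a single
    prime.\<close>
  have counts: "ideal_omega OK pOK = card S \<and> ideal_tau OK pOK = (k + 1) ^ card S
      \<and> ideal_tau_exp OK pOK = card {d. d dvd k} ^ card S"
    if S: "finite S" "\<And>Q. Q \<in> S \<Longrightarrow> primeideal Q OK" "k > 0"
      "pOK = (\<Otimes>\<^bsub>ideals_set OK\<^esub>Q\<in>S. Q [^]\<^bsub>ideals_set OK\<^esub> k)" for S and k :: nat
    using R.ideal_divisor_functions[OF canc
        R.is_ideal_factorization_uniform[OF S(1-3) pOK0 S(4)]] S(3)
    by simp
  have single: "ideal_omega OK pOK = 1 \<and> ideal_tau OK pOK = k + 1"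
    if "primeideal Q OK" "k > 0" "pOK = Q [^]\<^bsub>ideals_set OK\<^esub> k" for Q and k :: nat
  proof -
    have "ideal Q OK" using that(1) by (rule primeideal.axioms)
    then have "pOK = (\<Otimes>\<^bsub>ideals_set OK\<^esub>Q\<in>{Q}. Q [^]\<^bsub>ideals_set OK\<^esub> k)"
      using that(3) R.ideal_pow[of Q k] by (simp add: R.ideal_prod_one R.oneideal)
    then have "ideal_omega OK pOK = card {Q}" "ideal_tau OK pOK = (k + 1) ^ card {Q}"
      using counts[of "{Q}" k] that(1,2) by blast+
    then show ?thesis by simp
  qed
  have Pid: "\<And>i. i \<in> {1..g} \<Longrightarrow> ideal (P i) OK"
    using prime by (meson primeideal.axioms(1))
  \<comment> \<open>Injectivity of \<open>P\<close> turns the product over indices into one over the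
    set of primes.\<close>
  have "pOK = (\<Otimes>\<^bsub>ideals_set OK\<^esub>Q\<in>P ` {1..g}. Q [^]\<^bsub>ideals_set OK\<^esub> e)"
    unfolding assms(12)
    by (rule I.finprod_reindex[symmetric]) (use Pid assms(11) in \<open>auto simp: R.ideal_pow\<close>)
  then have "ideal_omega OK pOK = card (P ` {1..g}) \<and> ideal_tau OK pOK = (e + 1) ^ card (P ` {1..g})
      \<and> ideal_tau_exp OK pOK = card {d. d dvd e} ^ card (P ` {1..g})"
    using prime assms(9) by (intro counts) blast+
  then have vals: "ideal_omega OK pOK = g" "ideal_tau OK pOK = (e + 1) ^ g"
    "ideal_tau_exp OK pOK = card {d. d dvd e} ^ g"
    using card_image[OF assms(11)] by simp_all
  obtain h where h: "g = Suc h" using \<open>g > 0\<close> gr0_implies_Suc by blast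
  let ?d = "card {d. d dvd e}"
  \<comment> \<open>The factor \<open>g\<close> cancels against omega, and \<open>e + 1\<close>
    lowers the exponent \<open>g\<close> of tau to \<open>h\<close>.\<close>
  have quot: "real (ideal_tau OK pOK) / real (ideal_omega OK pOK) * (real g / (real e + 1))
      = real ((e + 1) ^ h)"
  proof -
    have "real e + 1 > 0" by simp
    then show ?thesis by (simp add: vals h divide_simps) (simp add: algebra_simps)
  qed
  \<comment> \<open>Subtracting the quotient term leaves \<open>e * (e + 1) ^ h\<close>, to be
    compared with \<open>?d ^ Suc h\<close>.\<close>
  have tau: "ideal_tau OK pOK = e * (e + 1) ^ h + (e + 1) ^ h"
    by (simp add: vals h)
  note arith = power_le_mult_power[OF card_divisors_le[OF assms(9)] assms(9), of h]
  have "primeideal pOK OK \<or> (\<exists>Q. primeideal Q OK \<and> pOK = Q [^]\<^bsub>ideals_set OK\<^esub> (2::nat))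
      \<longleftrightarrow> h = 0 \<and> ?d = e"
  proof
    assume "primeideal pOK OK \<or> (\<exists>Q. primeideal Q OK \<and> pOK = Q [^]\<^bsub>ideals_set OK\<^esub> (2::nat))"
    \<comment> \<open>Both alternatives are powers of one prime with \<open>k = 1\<close> or
      \<open>k = 2\<close>. Comparing omega and tau with their known values gives
      \<open>g = 1\<close> and \<open>e = k\<close>.\<close>
    then obtain Q k where "primeideal Q OK" "k = 1 \<or> k = (2::nat)"
      "pOK = Q [^]\<^bsub>ideals_set OK\<^esub> k"
      using I.nat_pow_eone[of pOK] by (metis ideals_set_simps(1) mem_Collect_eq primeideal.axioms(1))
    then have "g = 1" "(e + 1) ^ g = k + 1" "k = 1 \<or> k = 2"
      using single[of Q k] vals by auto
    then show "h = 0 \<and> ?d = e"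
      using card_divisors_eq_iff[OF assms(9)] h by simp
  next
    assume "h = 0 \<and> ?d = e"
    \<comment> \<open>With \<open>g = 1\<close> the product has the single factor
      \<open>P 1\<close>, and the divisor count leaves only the exponents 1 and 2.\<close>
    then have "pOK = P 1 [^]\<^bsub>ideals_set OK\<^esub> e" "e = 1 \<or> e = 2"
      using assms(12) h Pid[of 1] card_divisors_eq_iff[OF assms(9)]
      by (simp_all add: R.ideal_pow R.ideal_prod_one R.oneideal)
    then show "primeideal pOK OK \<or> (\<exists>Q. primeideal Q OK \<and> pOK = Q [^]\<^bsub>ideals_set OK\<^esub> (2::nat))"
      using prime[of 1] Pid[of 1] I.nat_pow_eone[of "P 1"] h by auto
  qed
  moreover have "?d ^ g = ideal_tau_exp OK pOK" by (simp add: vals)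
  ultimately have "ideal_tau_exp OK pOK + (e + 1) ^ h \<le> ideal_tau OK pOK"
    "ideal_tau OK pOK = ideal_tau_exp OK pOK + (e + 1) ^ h \<longleftrightarrow>
      primeideal pOK OK \<or> (\<exists>Q. primeideal Q OK \<and> pOK = Q [^]\<^bsub>ideals_set OK\<^esub> (2::nat))"
    using arith tau h by auto
  then show ?thesis
    unfolding quot by (simp only: flip: of_nat_add) (simp only: of_nat_le_iff of_nat_eq_iff)
qed

end
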